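(* Let $g\in\mathbb{C}^N$. If $|\widehat g(\lambda_l)|>0$ for all $l\in\{1,\dots,N\}$, then the collection $\{T_i g : 1\le i\le m\}$ is linearly independent for every $m\le N$.
   Context: Let $G$ be an undirected, connected, weighted graph with vertex set $\mathcal V=\{1,\dots,N\}$, and let $A$ be an $N\times N$ diagonalizable matrix associated with $G$ (for example its adjacency matrix or its graph Laplacian), with eigenvalues $\lambda_1,\dots,\lambda_N$ (listed with multiplicity) and corresponding eigenvectors $\chi_1,\dots,\chi_N$ forming an orthonormal basis of $\mathbb{C}^N$. A signal $f:\mathcal V\to\mathbb{C}$ is identified with the vector $(f(1),\dots,f(N))\in\mathbb{C}^N$. The graph Fourier transform of $f\in\mathbb{C}^N$ is $\widehat f(\lambda_l)=\sum_{n=1}^N f(n)\overline{\chi_l(n)}$, $l=1,\dots,N$ (indexed by $l$). The generalized convolution is $(f\ast g)(n)=\sum_{l=1}^N \widehat f(\lambda_l)\widehat g(\lambda_l)\chi_l(n)$. For $i=1,\dots,N$, $\delta_i\in\mathbb{C}^N$ is given by $\delta_i(n)=1$ if $n=i$ and $0$ otherwise, and the generalized translation is $T_i f=\sqrt N\,(f\ast\delta_i)$. Collections such as $\{T_i g:1\le i\le m\}$ are regarded as families indexed by $i$. *)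

theory Defs
  imports
    "Jordan_Normal_Form.VS_Connect"
    "Jordan_Normal_Form.Char_Poly"
    "Jordan_Normal_Form.Conjugate"
    "Graph_Theory.Graph_Theory"
begin

text \<open>Vertices and eigenpairs are numbered \<open>0, \<dots>, N - 1\<close> instead of \<open>1, \<dots>, N\<close>, following the
  indexing of \<^typ>\<open>complex vec\<close>; a signal is an element of \<open>carrier_vec N\<close>.\<close>

text \<open>An undirected edge is a pair of opposite arcs carrying the same weight. Loops are allowed and
  no sign is imposed on the weights. \<^const>\<open>Digraph_Component.connected\<close> of a digraph includes nonemptiness,
  hence \<open>N > 0\<close>.\<close>

locale weighted_graph = pair_pseudo_graph G
  for N :: nat and G :: "nat pair_pre_digraph" and w :: "(nat \<times> nat) weight_fun" +
  assumes vertices: "pverts G = {..<N}"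
    and connected: "Digraph_Component.connected (with_proj G)"
    and weight_sym: "\<And>i j. (i, j) \<in> parcs G \<Longrightarrow> w (i, j) = w (j, i)"

definition diagonalizable_mat :: "complex mat \<Rightarrow> bool" where
  "diagonalizable_mat A \<longleftrightarrow> (\<exists>B. diagonal_mat B \<and> similar_mat A B)"

definition orthonormal_basis :: "nat \<Rightarrow> (nat \<Rightarrow> complex vec) \<Rightarrow> bool" where
  "orthonormal_basis N \<chi> \<longleftrightarrow>
     (\<forall>k<N. \<forall>l<N. \<chi> k \<bullet>c \<chi> l = (if k = l then 1 else 0)) \<and>
     vectorspace.basis class_ring (module_vec TYPE(complex) N) (\<chi> ` {..<N})"

text \<open>The transform is a function of the index \<open>l\<close>, not of the eigenvalue itself: a repeated
  eigenvalue contributes one coefficient per listed eigenvector.\<close>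

definition graph_fourier :: "nat \<Rightarrow> (nat \<Rightarrow> complex vec) \<Rightarrow> complex vec \<Rightarrow> nat \<Rightarrow> complex" where
  "graph_fourier N \<chi> f l = (\<Sum>n<N. f $ n * cnj (\<chi> l $ n))"

definition graph_conv ::
  "nat \<Rightarrow> (nat \<Rightarrow> complex vec) \<Rightarrow> complex vec \<Rightarrow> complex vec \<Rightarrow> complex vec" where
  "graph_conv N \<chi> f g =
     vec N (\<lambda>n. \<Sum>l<N. graph_fourier N \<chi> f l * graph_fourier N \<chi> g l * \<chi> l $ n)"

definition graph_translate :: "nat \<Rightarrow> (nat \<Rightarrow> complex vec) \<Rightarrow> nat \<Rightarrow> complex vec \<Rightarrow> complex vec" where
  "graph_translate N \<chi> i f = complex_of_real (sqrt (real N)) \<cdot>\<^sub>v graph_conv N \<chi> f (unit_vec N i)"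

text \<open>Independence of a finite family, so repeated members count as dependent;
  \<open>module.lin_dep\<close> only speaks about the set of members.\<close>

definition lin_indpt_family :: "nat \<Rightarrow> 'i set \<Rightarrow> ('i \<Rightarrow> complex vec) \<Rightarrow> bool" where
  "lin_indpt_family N I v \<longleftrightarrow>
     (\<forall>c :: 'i \<Rightarrow> complex.
        finsum_vec TYPE(complex) N (\<lambda>i. c i \<cdot>\<^sub>v v i) I = 0\<^sub>v N \<longrightarrow> (\<forall>i\<in>I. c i = 0))"

end

(* Write chi_l for the basis vectors. A vanishing combination of the translates T_i g with coefficients c_i
   has, up to the factor sqrt N, l-th Fourier coefficient ghat(l) * d_l, where
   d_l = sum_i c_i cnj (chi_l(i)). As ghat does not vanish, all d_l are 0; and since a one-sided inverse
   of a square matrix is two-sided, the c_i are recovered from the d_l as c_j = sum_l d_l chi_l(j). *)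

theory Submission
  imports Defs
begin

text \<open>With the \<open>u l\<close> as rows of \<open>U\<close> and \<open>V\<close> its
  conjugate transpose, \<open>rows\<close> says that \<open>U * V\<close> is the identity. For
  square matrices this forces \<open>V * U\<close> to be the identity too, and the conclusion reads
  off its entries.\<close>

lemma orthonormal_columns:
  fixes u :: "nat \<Rightarrow> nat \<Rightarrow> complex"
  assumes rows: "\<And>k l. k < N \<Longrightarrow> l < N \<Longrightarrow> (\<Sum>n<N. u k n * cnj (u l n)) = (if k = l then 1 else 0)"
    and "i < N" "j < N"
  shows "(\<Sum>l<N. cnj (u l i) * u l j) = (if i = j then 1 else 0)"
proof -
  define U where "U = mat N N (\<lambda>(l, n). u l n)"
  define V where "V = mat N N (\<lambda>(n, l). cnj (u l n))"
  have "U * V = 1\<^sub>m N"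
    by (rule eq_matI) (simp_all add: U_def V_def scalar_prod_def rows flip: lessThan_atLeast0)
  then have "V * U = 1\<^sub>m N"
    by (rule mat_mult_left_right_inverse[rotated 2]) (simp_all add: U_def V_def)
  then have "(V * U) $$ (i, j) = (if i = j then 1 else 0)"
    using assms by simp
  then show ?thesis
    using assms by (simp add: U_def V_def scalar_prod_def flip: lessThan_atLeast0)
qed

lemma graph_fourier_unit_vec:
  assumes "i < N"
  shows "graph_fourier N \<chi> (unit_vec N i) l = cnj (\<chi> l $ i)"
proof -
  have "graph_fourier N \<chi> (unit_vec N i) l = (\<Sum>n<N. if n = i then cnj (\<chi> l $ n) else 0)"
    unfolding graph_fourier_def using assms by (intro sum.cong) (auto simp: unit_vec_def)
  then show ?thesis
    using assms by simp
qed

lemma graph_translate_carrier: "graph_translate N \<chi> i g \<in> carrier_vec N"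
  by (simp add: graph_translate_def graph_conv_def)

text \<open>On the Fourier side, translation to vertex \<open>i\<close> multiplies the
  \<open>l\<close>-th coefficient of \<open>g\<close> by \<open>cnj (\<chi> l $ i)\<close>, up to
  the normalising factor; this is the only way \<open>i\<close> enters.\<close>

lemma index_graph_translate:
  assumes "i < N" "n < N"
  shows "graph_translate N \<chi> i g $ n =
    complex_of_real (sqrt (real N)) * (\<Sum>l<N. graph_fourier N \<chi> g l * cnj (\<chi> l $ i) * \<chi> l $ n)"
  using assms by (simp add: graph_translate_def graph_conv_def graph_fourier_unit_vec)

text \<open>Pairing the vanishing expansion with \<open>u k\<close> and exchanging the two sums
  isolates \<open>a k\<close> by orthonormality.\<close>

lemma orthonormal_expansion_eq_0:
  fixes u :: "nat \<Rightarrow> nat \<Rightarrow> complex"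
  assumes rows: "\<And>k l. k < N \<Longrightarrow> l < N \<Longrightarrow> (\<Sum>n<N. u k n * cnj (u l n)) = (if k = l then 1 else 0)"
    and zero: "\<And>n. n < N \<Longrightarrow> (\<Sum>l<N. a l * u l n) = 0"
    and "k < N"
  shows "a k = 0"
proof -
  have "0 = (\<Sum>n<N. (\<Sum>l<N. a l * u l n) * cnj (u k n))"
    by (simp add: zero)
  also have "\<dots> = (\<Sum>l<N. \<Sum>n<N. a l * u l n * cnj (u k n))"
    unfolding sum_distrib_right by (rule sum.swap)
  also have "\<dots> = (\<Sum>l<N. a l * (\<Sum>n<N. u l n * cnj (u k n)))"
    by (simp add: sum_distrib_left mult.assoc)
  also have "\<dots> = (\<Sum>l<N. if l = k then a l else 0)"
    by (rule sum.cong) (simp_all add: rows \<open>k < N\<close>)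
  also have "\<dots> = a k"
    using \<open>k < N\<close> by simp
  finally show ?thesis
    by simp
qed

text \<open>Any set \<open>I\<close> of vertices is allowed, because each coefficient
  \<open>c j\<close> is recovered separately from the Fourier data.\<close>

lemma lin_indpt_family_graph_translate:
  assumes ortho: "\<And>k l. k < N \<Longrightarrow> l < N \<Longrightarrow> \<chi> k \<bullet>c \<chi> l = (if k = l then 1 else 0)"
    and carrier: "\<And>l. l < N \<Longrightarrow> \<chi> l \<in> carrier_vec N"
    and nonzero: "\<And>l. l < N \<Longrightarrow> graph_fourier N \<chi> g l \<noteq> 0"
    and "I \<subseteq> {..<N}"
  shows "lin_indpt_family N I (\<lambda>i. graph_translate N \<chi> i g)"
  unfolding lin_indpt_family_def
proof (intro allI impI ballI)
  fix c :: "nat \<Rightarrow> complex" and j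
  assume comb: "finsum_vec TYPE(complex) N (\<lambda>i. c i \<cdot>\<^sub>v graph_translate N \<chi> i g) I = 0\<^sub>v N"
    and "j \<in> I"
  have fin: "finite I"
    using \<open>I \<subseteq> {..<N}\<close> finite_subset by blast
  have "j < N"
    using \<open>j \<in> I\<close> \<open>I \<subseteq> {..<N}\<close> by auto
  \<comment> \<open>Orthonormality in coordinates, the form that the auxiliary lemmas take.\<close>
  have rows: "(\<Sum>n<N. \<chi> k $ n * cnj (\<chi> l $ n)) = (if k = l then 1 else 0)" if "k < N" "l < N" for k l
  proof -
    have "\<chi> k \<bullet>c \<chi> l = (\<Sum>n<N. \<chi> k $ n * cnj (\<chi> l $ n))"
      using carrier[OF \<open>l < N\<close>]
      by (auto simp: scalar_prod_def lessThan_atLeast0 intro!: sum.cong)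
    then show ?thesis
      using ortho that by simp
  qed
  \<comment> \<open>\<open>d l\<close> is the \<open>l\<close>-th Fourier coefficient of the signal
    that equals \<open>c\<close> on \<open>I\<close> and 0 elsewhere.\<close>
  define d where "d l = (\<Sum>i\<in>I. c i * cnj (\<chi> l $ i))" for l
  have "(\<Sum>l<N. (graph_fourier N \<chi> g l * d l) * \<chi> l $ n) = 0" if "n < N" for n
  proof -
    let ?s = "complex_of_real (sqrt (real N))"
    have "0 = finsum_vec TYPE(complex) N (\<lambda>i. c i \<cdot>\<^sub>v graph_translate N \<chi> i g) I $ n"
      using comb that by simp
    also have "\<dots> = (\<Sum>i\<in>I. (c i \<cdot>\<^sub>v graph_translate N \<chi> i g) $ n)"
      using fin that graph_translate_carrier by (intro index_finsum_vec) auto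
    also have "\<dots> = (\<Sum>i\<in>I. c i *
        (?s * (\<Sum>l<N. graph_fourier N \<chi> g l * cnj (\<chi> l $ i) * \<chi> l $ n)))"
    proof (rule sum.cong)
      fix i assume "i \<in> I"
      then have "i < N"
        using \<open>I \<subseteq> {..<N}\<close> by auto
      then show "(c i \<cdot>\<^sub>v graph_translate N \<chi> i g) $ n =
          c i * (?s * (\<Sum>l<N. graph_fourier N \<chi> g l * cnj (\<chi> l $ i) * \<chi> l $ n))"
        using that carrier_vecD[OF graph_translate_carrier, of N \<chi> i g]
        by (simp add: index_graph_translate)
    qed simp
    also have "\<dots> = (\<Sum>i\<in>I. \<Sum>l<N. ?s * (graph_fourier N \<chi> g l * (c i * cnj (\<chi> l $ i)) * \<chi> l $ n))"
      by (simp add: sum_distrib_left mult_ac)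
    also have "\<dots> = (\<Sum>l<N. \<Sum>i\<in>I. ?s * (graph_fourier N \<chi> g l * (c i * cnj (\<chi> l $ i)) * \<chi> l $ n))"
      by (rule sum.swap)
    also have "\<dots> = ?s * (\<Sum>l<N. (graph_fourier N \<chi> g l * d l) * \<chi> l $ n)"
      by (simp add: d_def sum_distrib_left sum_distrib_right)
    \<comment> \<open>The factor \<open>?s\<close> cancels: \<open>n < N\<close> gives
      \<open>N > 0\<close>, so the square root is nonzero.\<close>
    finally show ?thesis
      using that by auto
  qed
  then have "graph_fourier N \<chi> g l * d l = 0" if "l < N" for l
    using orthonormal_expansion_eq_0[of N "\<lambda>l n. \<chi> l $ n" "\<lambda>l. graph_fourier N \<chi> g l * d l" l]
      rows that by blast
  then have d0: "d l = 0" if "l < N" for l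
    using nonzero that by auto
  \<comment> \<open>Fourier inversion at vertex \<open>j\<close>: the column relations replace the
    Kronecker delta, and exchanging the sums leaves a combination of the \<open>d l\<close>.\<close>
  have "c j = (\<Sum>i\<in>I. if i = j then c i else 0)"
    using \<open>j \<in> I\<close> fin by simp
  also have "\<dots> = (\<Sum>i\<in>I. c i * (\<Sum>l<N. cnj (\<chi> l $ i) * \<chi> l $ j))"
  proof (rule sum.cong)
    fix i assume "i \<in> I"
    then have "i < N"
      using \<open>I \<subseteq> {..<N}\<close> by auto
    then have "(\<Sum>l<N. cnj (\<chi> l $ i) * \<chi> l $ j) = (if i = j then 1 else 0)"
      using orthonormal_columns[of N "\<lambda>l n. \<chi> l $ n" i j] rows \<open>j < N\<close> by blast
    then show "(if i = j then c i else 0) = c i * (\<Sum>l<N. cnj (\<chi> l $ i) * \<chi> l $ j)"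
      by simp
  qed simp
  also have "\<dots> = (\<Sum>i\<in>I. \<Sum>l<N. c i * cnj (\<chi> l $ i) * \<chi> l $ j)"
    by (simp add: sum_distrib_left mult.assoc)
  also have "\<dots> = (\<Sum>l<N. d l * \<chi> l $ j)"
    unfolding d_def sum_distrib_right by (rule sum.swap)
  also have "\<dots> = 0"
    by (simp add: d0)
  finally show "c j = 0" .
qed

theorem theorem4p1:
  fixes N :: nat
    and G :: "nat pair_pre_digraph" and w :: "(nat \<times> nat) weight_fun"
    and A :: "complex mat" and ev :: "nat \<Rightarrow> complex" and \<chi> :: "nat \<Rightarrow> complex vec"
    and g :: "complex vec"
  assumes "weighted_graph N G w"
    and "A \<in> carrier_mat N N"
    and "diagonalizable_mat A"
    and "char_poly A = (\<Prod>l<N. [:- ev l, 1:])"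
    and "\<And>l. l < N \<Longrightarrow> eigenvector A (\<chi> l) (ev l)"
    and "orthonormal_basis N \<chi>"
    and "g \<in> carrier_vec N"
    and "\<And>l. l < N \<Longrightarrow> cmod (graph_fourier N \<chi> g l) > 0"
  shows "\<forall>m\<le>N. lin_indpt_family N {..<m} (\<lambda>i. graph_translate N \<chi> i g)"
proof (intro allI impI)
  fix m assume "m \<le> N"
  show "lin_indpt_family N {..<m} (\<lambda>i. graph_translate N \<chi> i g)"
  proof (rule lin_indpt_family_graph_translate)
    \<comment> \<open>The dimension of \<open>\<chi> l\<close> is part of being an eigenvector of
      \<open>A\<close>, whose row dimension is \<open>N\<close>.\<close>
    show "\<chi> l \<in> carrier_vec N" if "l < N" for l
      using assms(2) assms(5)[OF that] by (simp add: eigenvector_def)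
    show "\<chi> k \<bullet>c \<chi> l = (if k = l then 1 else 0)" if "k < N" "l < N" for k l
      using assms(6) that unfolding orthonormal_basis_def by blast
    show "graph_fourier N \<chi> g l \<noteq> 0" if "l < N" for l
      using assms(8)[OF that] by simp
    show "{..<m} \<subseteq> {..<N}"
      using \<open>m \<le> N\<close> by auto
  qed
qed

end
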